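(* Let $A_1,A_2$ be $2\times 2$ upper-triangular complex matrices which are each diagonalisable but are not simultaneously diagonalisable, which both have spectral radius equal to $1$, and which satisfy $|\det A_1|=|\det A_2|=1$. Then there exist a sequence $\sigma\colon\mathbb{N}\to\{1,2\}$ and a vector $v\in\mathbb{C}^2$ such that \[\liminf_{n\to\infty}\frac{1}{n}\left\|A_{\sigma(n)}\cdots A_{\sigma(1)}v\right\|>0.\]
   Context: $\mathbb{N}=\{1,2,3,\ldots\}$ and $\|\cdot\|$ denotes the Euclidean norm on $\mathbb{C}^2$. Two matrices are simultaneously diagonalisable if there is a single basis of $\mathbb{C}^2$ in which both are diagonal. *)

theory Defs
  imports "HOL-Analysis.Analysis"
begin

definition diagonal_matrix :: "'a::zero^'n^'n \<Rightarrow> bool" where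
  "diagonal_matrix A \<longleftrightarrow> (\<forall>i j. i \<noteq> j \<longrightarrow> A $ i $ j = 0)"

(* The columns of the invertible matrix P are the basis in which A becomes diagonal. *)
definition diagonalisable :: "'a::field^'n^'n \<Rightarrow> bool" where
  "diagonalisable A \<longleftrightarrow> (\<exists>P::'a^'n^'n. invertible P \<and> diagonal_matrix (matrix_inv P ** A ** P))"

definition simultaneously_diagonalisable :: "'a::field^'n^'n \<Rightarrow> 'a^'n^'n \<Rightarrow> bool" where
  "simultaneously_diagonalisable A B \<longleftrightarrow>
     (\<exists>P::'a^'n^'n. invertible P \<and> diagonal_matrix (matrix_inv P ** A ** P)
                          \<and> diagonal_matrix (matrix_inv P ** B ** P))"

(* Spelled out by entries, because in the numeral type 2 one has 2 = 0, so that 2 < 1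
   in its order and a condition of the form "A $ i $ j = 0 for j < i" would describe
   lower-triangular matrices. *)
definition upper_triangular2 :: "'a::zero^2^2 \<Rightarrow> bool" where
  "upper_triangular2 A \<longleftrightarrow> A $ 2 $ 1 = 0"

definition eigenvalues :: "'a::field^'n^'n \<Rightarrow> 'a set" where
  "eigenvalues A = {c. \<exists>v. v \<noteq> 0 \<and> A *v v = c *s v}"

(* A complex square matrix has finitely many eigenvalues and at least one, so Max is meaningful. *)
definition spectral_radius :: "complex^'n^'n \<Rightarrow> real" where
  "spectral_radius A = Max (cmod ` eigenvalues A)"

(* matrix_product B n = B n ** ... ** B 1; the value B 0 is never used. *)
primrec matrix_product :: "(nat \<Rightarrow> 'a::semiring_1^'n^'n) \<Rightarrow> nat \<Rightarrow> 'a^'n^'n" where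
  "matrix_product B 0 = mat 1"
| "matrix_product B (Suc n) = B (Suc n) ** matrix_product B n"

end

theory Submission
  imports Defs
begin

text \<open>
An upper-triangular matrix with diagonal entries \<open>a\<close>, \<open>d\<close> and corner entry \<open>b\<close> sends the line
through \<open>(z, 1)\<close> to the line through \<open>((a z + b) / d, 1)\<close>. The spectral radius and the determinant
force \<open>\<bar>a\<bar> = \<bar>d\<bar> = 1\<close>, so the two matrices act on the affine chart of \<open>z\<close> by Euclidean isometries of
the plane, and second coordinates keep their modulus. A vector \<open>(z, 1)\<close> thus grows as fast as the
orbit of \<open>z\<close>. If \<open>a = d\<close>, the matrix is diagonalisable only as a scalar, and then it is
diagonalisable together with any other. So both isometries are proper rotations; a common centre
\<open>p\<close> would give the common eigenbasis \<open>(1, 0)\<close>, \<open>(p, 1)\<close>, hence their centres are distinct.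

It remains to escape to infinity at linear speed with two rotations about distinct centres, without
using inverses. It suffices that from every point some word of bounded length increases a suitable
gauge by a fixed amount (lemma \<open>linear_growth_from_bounded_words\<close>). If one of the rotations, with
multiplier \<open>c\<close>, is not a half-turn, the gauge is the distance to its centre. Seen from there, the
other rotation is an isometry that moves the centre by some \<open>b \<noteq> 0\<close>; it gains distance when it is applied to a
point in a favourable direction, and the first rotation turns the point into such a direction
for free, because the powers of \<open>c\<close> are not confined to a half-plane and reach every open half-plane
after boundedly many steps (lemma \<open>unimodular_powers_visit_right_half_plane\<close>). If both are half-turns,
this fails for points seen perpendicularly to \<open>b\<close>, but then the product of the two is a translation,
and the coordinate in its direction serves as gauge.
\<close>

section \<open>Linear growth from words of bounded length\<close>

text \<open>
The sequence is built one letter at a time while carrying the rest of the current word, the pending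
word. A single letter may lower \<open>g\<close>, so the invariant bounds \<open>g\<close> not at the current point but at the
point where the pending word will end. Two functions appear because the gauge \<open>g\<close> that grows along
complete words need not be controlled along single letters: a half-turn reverses a linear
coordinate. It is the majorant \<open>h\<close> that grows little until the pending word ends.
\<close>

lemma linear_growth_from_bounded_words:
  fixes f :: "'i \<Rightarrow> 'x \<Rightarrow> 'x" and g h :: "'x \<Rightarrow> real"
  assumes gain: "\<And>x. \<exists>w. w \<noteq> [] \<and> set w \<subseteq> L \<and> length w \<le> N \<and> g x + \<delta> \<le> g (fold f w x)"
    and "\<delta> > 0"
    and le: "\<And>x. g x \<le> h x"
    and step: "\<And>i x. i \<in> L \<Longrightarrow> h (f i x) \<le> h x + C" and "C \<ge> 0"
  shows "\<exists>\<sigma> x. (\<forall>n. \<sigma> n \<in> L) \<and> (\<forall>n. x (Suc n) = f (\<sigma> (Suc n)) (x n)) \<and>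
           (\<exists>\<epsilon>>0. \<exists>K. \<forall>n. \<epsilon> * real n - K \<le> h (x n))"
proof -
  obtain x0 :: 'x where True by blast
  have "N > 0"
    using gain[of x0] by (metis length_greater_0_conv less_le_trans)
  define \<epsilon> where "\<epsilon> = \<delta> / real N"
  have \<epsilon>: "\<epsilon> > 0" "\<epsilon> * real N = \<delta>"
    using \<open>N > 0\<close> \<open>\<delta> > 0\<close> by (auto simp: \<epsilon>_def)
  \<comment> \<open>Spending \<open>\<epsilon>\<close> per letter, the gain \<open>\<delta>\<close> of a fresh word pays for all of its at most \<open>N\<close> letters.\<close>
  define inv where "inv n s \<longleftrightarrow> (case s of (x, w) \<Rightarrow> w \<noteq> [] \<and> set w \<subseteq> L \<and> length w \<le> N \<and>
      g x0 + \<epsilon> * (real n + real (length w)) \<le> g (fold f w x))" for n :: nat and s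
  have fresh: "\<exists>w. inv n (x, w)" if "g x0 + \<epsilon> * real n \<le> g x" for n x
  proof -
    obtain w where w: "w \<noteq> []" "set w \<subseteq> L" "length w \<le> N" "g x + \<delta> \<le> g (fold f w x)"
      using gain by blast
    have "\<epsilon> * real (length w) \<le> \<epsilon> * real N"
      using w(3) \<epsilon>(1) by simp
    then have "inv n (x, w)"
      using w that \<epsilon>(2) by (auto simp: inv_def algebra_simps)
    then show ?thesis ..
  qed
  have "\<exists>s. \<forall>n. inv n (s n) \<and> fst (s (Suc n)) = f (hd (snd (s n))) (fst (s n))"
  proof (rule dependent_nat_choice)
    show "\<exists>s. inv 0 s" using fresh[of 0 x0] by auto
  next
    fix s n assume "inv n s"
    moreover obtain x w where s: "s = (x, w)" by force
    ultimately obtain i v where w: "w = i # v" and v: "set v \<subseteq> L" "Suc (length v) \<le> N"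
      and val: "g x0 + \<epsilon> * (real n + real (Suc (length v))) \<le> g (fold f v (f i x))"
      by (cases w) (auto simp: inv_def)
    have "\<exists>w'. inv (Suc n) (f i x, w')"
    proof (cases "v = []")
      case True
      then show ?thesis using val by (intro fresh) (simp add: add.commute)
    next
      case False
      then have "inv (Suc n) (f i x, v)"
        using v val by (simp add: inv_def algebra_simps)
      then show ?thesis ..
    qed
    then show "\<exists>t. inv (Suc n) t \<and> fst t = f (hd (snd s)) (fst s)"
      using s w by auto
  qed
  then obtain s where s: "\<And>n. inv n (s n)" "\<And>n. fst (s (Suc n)) = f (hd (snd (s n))) (fst (s n))"
    by blast
  define x where "x n = fst (s n)" for n
  \<comment> \<open>The letter leading from \<open>x n\<close> to \<open>x (Suc n)\<close> carries the index \<open>Suc n\<close>.\<close>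
  define \<sigma> where "\<sigma> n = hd (snd (s (n - 1)))" for n
  have word_bound: "h (fold f w y) \<le> h y + C * real (length w)" if "set w \<subseteq> L" for w y
    using that
  proof (induction w arbitrary: y)
    case (Cons i w)
    have "h (fold f w (f i y)) \<le> h (f i y) + C * real (length w)"
      using Cons by simp
    also have "\<dots> \<le> h y + C + C * real (length w)"
      using step Cons.prems by simp
    finally show ?case by (simp add: algebra_simps)
  qed simp
  have "\<sigma> n \<in> L" for n
    using s(1)[of "n - 1"] by (auto simp: \<sigma>_def inv_def split: prod.splits)
  moreover have "x (Suc n) = f (\<sigma> (Suc n)) (x n)" for n
    using s(2) by (simp add: x_def \<sigma>_def)
  moreover have "\<epsilon> * real n - (C * real N - g x0) \<le> h (x n)" for n
  proof -
    obtain w where w: "set w \<subseteq> L" "length w \<le> N"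
      "g x0 + \<epsilon> * (real n + real (length w)) \<le> g (fold f w (x n))"
      using s(1)[of n] by (auto simp: x_def inv_def split: prod.splits)
    have "0 \<le> \<epsilon> * real (length w)" using \<epsilon>(1) by simp
    then have "g x0 + \<epsilon> * real n \<le> g (fold f w (x n))"
      using w(3) by (simp add: algebra_simps)
    also have "\<dots> \<le> h (x n) + C * real (length w)"
      using le word_bound[OF w(1)] order_trans by blast
    also have "\<dots> \<le> h (x n) + C * real N"
      using w(2) \<open>C \<ge> 0\<close> by (simp add: mult_left_mono)
    finally show ?thesis by simp
  qed
  ultimately show ?thesis using \<epsilon>(1) by blast
qed

section \<open>Powers of a unimodular number\<close>

lemma norm_geometric_sum_le:
  fixes c :: complex
  assumes "cmod c = 1" and "c \<noteq> 1"
  shows "cmod (\<Sum>k<n. c ^ k) \<le> 2 / cmod (c - 1)"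
proof -
  have "cmod (c ^ n - 1) \<le> cmod (c ^ n) + cmod 1"
    by (rule norm_triangle_ineq4)
  then show ?thesis
    using assms by (simp add: sum_gp_strict norm_divide norm_power divide_right_mono norm_minus_commute)
qed

text \<open>
The geometric sums of \<open>c\<close> and of \<open>c\<^sup>2\<close> are bounded, so along the powers of \<open>c\<close> the average of
\<open>x = Re (w * c ^ k)\<close> tends to \<open>0\<close> and, as \<open>2 * x\<^sup>2 - 1 = Re ((w * c ^ k)\<^sup>2)\<close>, the average of \<open>x\<^sup>2\<close> tends
to \<open>1/2\<close>. But \<open>x \<le> 1/8\<close> throughout would put \<open>x\<^sup>2\<close> below the chord \<open>1/8 - 7/8 * x\<close> of the parabola
over the interval from \<open>-1\<close> to \<open>1/8\<close>, whose average tends to \<open>1/8\<close>. All bounds are uniform in \<open>w\<close>.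
\<close>

lemma unimodular_powers_visit_right_half_plane:
  fixes c :: complex
  assumes c: "cmod c = 1" and c2: "c ^ 2 \<noteq> 1"
  shows "\<exists>N. \<forall>w. cmod w = 1 \<longrightarrow> (\<exists>k<N. Re (w * c ^ k) \<ge> 1/8)"
proof -
  have "c \<noteq> 1" using c2 by auto
  define B where "B = 2 / cmod (c - 1)"
  define B' where "B' = 2 / cmod (c ^ 2 - 1)"
  obtain N :: nat where N: "real N > 4 * B + 2 * B'"
    using reals_Archimedean2 by blast
  have "\<exists>k<N. Re (w * c ^ k) \<ge> 1/8" if w: "cmod w = 1" for w
  proof (rule ccontr)
    assume "\<not> ?thesis"
    then have small: "Re (w * c ^ k) < 1/8" if "k < N" for k
      using that by force
    have unit: "cmod (w * c ^ k) = 1" for k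
      using w c by (simp add: norm_mult norm_power)
    have "\<bar>Re (w * (\<Sum>k<N. c ^ k))\<bar> \<le> B"
      using norm_geometric_sum_le[OF c \<open>c \<noteq> 1\<close>, of N] w abs_Re_le_cmod[of "w * (\<Sum>k<N. c ^ k)"]
      by (simp add: norm_mult B_def)
    then have lin: "- B \<le> (\<Sum>k<N. Re (w * c ^ k))"
      by (simp add: sum_distrib_left del: times_complex.sel)
    have "\<bar>Re (w ^ 2 * (\<Sum>k<N. (c ^ 2) ^ k))\<bar> \<le> B'"
      using norm_geometric_sum_le[of "c ^ 2" N] c c2 w
        abs_Re_le_cmod[of "w ^ 2 * (\<Sum>k<N. (c ^ 2) ^ k)"]
      by (simp add: norm_mult norm_power B'_def)
    moreover have "(w * c ^ k) ^ 2 = w ^ 2 * (c ^ 2) ^ k" for k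
      by (simp add: power_mult_distrib flip: power_mult) (simp add: mult.commute)
    ultimately have quad: "- B' \<le> (\<Sum>k<N. Re ((w * c ^ k) ^ 2))"
      by (simp add: sum_distrib_left del: times_complex.sel)
    have "Re ((w * c ^ k) ^ 2) \<le> - 3 / 4 - 7 / 4 * Re (w * c ^ k)" if "k < N" for k
    proof -
      define u where "u = w * c ^ k"
      have "(Re u)\<^sup>2 + (Im u)\<^sup>2 = 1"
        using unit[of k] by (simp add: u_def flip: cmod_power2 del: times_complex.sel)
      then have "Re (u ^ 2) = 2 * (Re u)\<^sup>2 - 1"
        by (simp add: power2_eq_square)
      moreover have "(Re u + 1) * (Re u - 1/8) \<le> 0"
        using abs_Re_le_cmod[of u] unit[of k] small[OF that]
        by (intro mult_nonneg_nonpos) (auto simp: u_def simp del: times_complex.sel)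
      ultimately show ?thesis
        unfolding u_def[symmetric] by (simp add: power2_eq_square field_simps)
    qed
    then have "(\<Sum>k<N. Re ((w * c ^ k) ^ 2)) \<le> (\<Sum>k<N. - 3 / 4 - 7 / 4 * Re (w * c ^ k))"
      by (intro sum_mono) simp
    also have "\<dots> = - 3 / 4 * real N - 7 / 4 * (\<Sum>k<N. Re (w * c ^ k))"
      by (simp add: sum_subtractf sum_distrib_left del: times_complex.sel)
    finally have "3 * real N \<le> 7 * B + 4 * B'"
      using lin quad by linarith
    moreover have "B \<ge> 0" "B' \<ge> 0"
      by (simp_all add: B_def B'_def)
    ultimately show False using N by linarith
  qed
  then show ?thesis by blast
qed

section \<open>Two rotations with distinct centres\<close>

definition rotation :: "complex \<Rightarrow> complex \<Rightarrow> complex \<Rightarrow> complex" where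
  "rotation p c z = p + c * (z - p)"

lemma rotation_iterate: "(rotation p c ^^ k) z = p + c ^ k * (z - p)"
  by (induction k) (simp_all add: rotation_def)

text \<open>
The letters of a word are applied from left to right. If rotation \<open>i\<close> has a multiplier other than
\<open>-1\<close>, words \<open>i \<dots> i j\<close> increase the distance to its centre \<open>p i\<close>; two half-turns compose to a
translation by twice the difference of their centres.
\<close>

lemma rotation_orbits_escape:
  fixes p c :: "nat \<Rightarrow> complex"
  assumes unit: "\<And>i. i \<in> {1, 2} \<Longrightarrow> cmod (c i) = 1 \<and> c i \<noteq> 1" and "p 1 \<noteq> p 2"
  shows "\<exists>\<sigma> z. (\<forall>n. \<sigma> n \<in> {1, 2}) \<and> (\<forall>n. z (Suc n) = rotation (p (\<sigma> (Suc n))) (c (\<sigma> (Suc n))) (z n)) \<and>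
           (\<exists>\<epsilon>>0. \<exists>K. \<forall>n. \<epsilon> * real n - K \<le> cmod (z n))"
proof -
  let ?f = "\<lambda>i. rotation (p i) (c i)"
  obtain g h :: "complex \<Rightarrow> real" and N :: nat and \<delta> C D :: real
    where gain: "\<And>z. \<exists>w. w \<noteq> [] \<and> set w \<subseteq> {1, 2} \<and> length w \<le> N \<and> g z + \<delta> \<le> g (fold ?f w z)"
      and "\<delta> > 0" and le: "\<And>z. g z \<le> h z"
      and step: "\<And>i z. i \<in> {1, 2} \<Longrightarrow> h (?f i z) \<le> h z + C" and "C \<ge> 0"
      and h: "\<And>z. h z \<le> cmod z + D"
  proof (cases "\<exists>i\<in>{1, 2}. c i ^ 2 \<noteq> 1")
    case True
    then obtain i j where ij: "{1, 2} = {i, j}" "c i ^ 2 \<noteq> 1" "p i \<noteq> p j"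
      using \<open>p 1 \<noteq> p 2\<close> by (metis insertE insert_commute singletonD)
    then have c: "cmod (c i) = 1" "cmod (c j) = 1" "c j \<noteq> 1"
      using unit by blast+
    \<comment> \<open>With \<open>p i\<close> as origin, rotation \<open>j\<close> is multiplication by \<open>c j\<close> followed by a shift by \<open>b\<close>.\<close>
    define b where "b = (p j - p i) * (1 - c j)"
    have "b \<noteq> 0" using ij c by (simp add: b_def)
    obtain M where M: "\<And>w. cmod w = 1 \<Longrightarrow> \<exists>k<M. Re (w * c i ^ k) \<ge> 1/8"
      using unimodular_powers_visit_right_half_plane[OF c(1) ij(2)] by blast
    let ?h = "\<lambda>z. cmod (z - p i)"
    show thesis
    proof (rule that[of "Suc M" ?h "cmod b / 8" ?h "cmod b" "cmod (p i)"])
      fix z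
      define r where "r = cmod (z - p i)"
      \<comment> \<open>At the centre itself any direction serves.\<close>
      define u where "u = (if z = p i then 1 else sgn (z - p i))"
      have u: "cmod u = 1" "z - p i = of_real r * u"
        by (auto simp: u_def r_def sgn_eq norm_divide)
      \<comment> \<open>The number of turns is chosen so that rotation \<open>j\<close>, just before the shift, has brought the
          point close enough to the direction of \<open>b\<close>.\<close>
      have "cmod (cnj (sgn b) * c j * u) = 1"
        using u c \<open>b \<noteq> 0\<close> by (simp add: norm_mult norm_sgn)
      from M[OF this] obtain k where k: "k < M" "Re (cnj (sgn b) * c j * u * c i ^ k) \<ge> 1/8"
        by blast
      define q where "q = c j * c i ^ k * u"
      have "cmod q = 1" using c u by (simp add: q_def norm_mult norm_power)
      let ?w = "replicate k i @ [j]"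
      have "fold ?f ?w z - p i = b + of_real r * q"
        by (simp add: fold_replicate rotation_iterate) (simp add: rotation_def b_def q_def u algebra_simps)
      moreover have "r + cmod b / 8 \<le> cmod (b + of_real r * q)"
      proof -
        have "cmod b * (1 / 8) \<le> cmod b * Re (cnj (sgn b) * q)"
          using k(2) by (intro mult_left_mono) (simp_all add: q_def mult_ac del: times_complex.sel)
        also have "\<dots> = Re (cnj b * q)"
          using \<open>b \<noteq> 0\<close> by (simp add: sgn_div_norm field_simps)
        also have "\<dots> = Re (cnj q * b)"
          by simp
        finally have "r + cmod b / 8 \<le> Re (cnj q * b) + r"
          by simp
        also have "\<dots> = Re (cnj q * (b + of_real r * q))"
        proof -
          have "cnj q * q = 1" 
            using \<open>cmod q = 1\<close> complex_norm_square[of q] by (simp add: mult.commute)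
          then have "cnj q * (b + of_real r * q) = cnj q * b + of_real r"
            by (simp add: algebra_simps)
          then show ?thesis by simp
        qed
        also have "\<dots> \<le> cmod (cnj q * (b + of_real r * q))"
          by (rule complex_Re_le_cmod)
        also have "\<dots> = cmod (b + of_real r * q)"
          using \<open>cmod q = 1\<close> by (simp add: norm_mult)
        finally show ?thesis .
      qed
      ultimately show "\<exists>w. w \<noteq> [] \<and> set w \<subseteq> {1, 2} \<and> length w \<le> Suc M \<and>
          cmod (z - p i) + cmod b / 8 \<le> cmod (fold ?f w z - p i)"
        unfolding ij(1) using k(1) by (intro exI[of _ ?w]) (auto simp: r_def)
    next
      fix l z assume "l \<in> {1, 2::nat}"
      then consider "l = i" | "l = j" unfolding ij(1) by blast
      then show "cmod (?f l z - p i) \<le> cmod (z - p i) + cmod b"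
      proof cases
        case 1
        then show ?thesis using c by (simp add: rotation_def norm_mult)
      next
        case 2
        have "?f j z - p i = c j * (z - p i) + b"
          by (simp add: rotation_def b_def algebra_simps)
        then show ?thesis
          using norm_triangle_ineq[of "c j * (z - p i)" b] c 2 by (simp add: norm_mult)
      qed
    next
      show "cmod (z - p i) \<le> cmod z + cmod (p i)" for z
        by (rule norm_triangle_ineq4)
    qed (use \<open>b \<noteq> 0\<close> in auto)
  next
    case False
    then have c: "c 1 = -1" "c 2 = -1"
      using unit by (auto simp: power2_eq_1_iff)
    define t where "t = 2 * (p 2 - p 1)"
    have "t \<noteq> 0" using \<open>p 1 \<noteq> p 2\<close> by (simp add: t_def)
    let ?C = "2 * max (cmod (p 1)) (cmod (p 2))"
    show thesis
    proof (rule that[of 2 "\<lambda>z. Re (cnj (sgn t) * z)" "cmod t" cmod ?C 0])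
      fix z
      have "fold ?f [1, 2] z = z + t"
        by (simp add: rotation_def c t_def del: One_nat_def)
      moreover have "cnj (sgn t) * t = of_real (cmod t)"
        using \<open>t \<noteq> 0\<close> complex_norm_square[of t]
        by (simp add: sgn_div_norm scaleR_conv_of_real field_simps power2_eq_square)
      ultimately have "Re (cnj (sgn t) * z) + cmod t = Re (cnj (sgn t) * fold ?f [1, 2] z)"
        by (simp add: distrib_left del: times_complex.sel fold.simps)
      then show "\<exists>w. w \<noteq> [] \<and> set w \<subseteq> {1, 2} \<and> length w \<le> 2 \<and>
          Re (cnj (sgn t) * z) + cmod t \<le> Re (cnj (sgn t) * fold ?f w z)"
        by (intro exI[of _ "[1, 2]"]) (simp del: times_complex.sel fold.simps)
    next
      show "Re (cnj (sgn t) * z) \<le> cmod z" for z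
        using complex_Re_le_cmod[of "cnj (sgn t) * z"] \<open>t \<noteq> 0\<close> by (simp add: norm_mult norm_sgn)
    next
      fix i z assume i: "i \<in> {1, 2::nat}"
      have "?f i z = 2 * p i - z" using i c by (auto simp: rotation_def)
      then have "cmod (?f i z) \<le> 2 * cmod (p i) + cmod z"
        using norm_triangle_ineq4[of "2 * p i" z] by (simp add: norm_mult)
      then show "cmod (?f i z) \<le> cmod z + ?C"
        using i by auto
    qed (use \<open>t \<noteq> 0\<close> in \<open>auto simp: le_max_iff_disj\<close>)
  qed
  have "\<exists>\<sigma> z. (\<forall>n. \<sigma> n \<in> {1, 2}) \<and> (\<forall>n. z (Suc n) = ?f (\<sigma> (Suc n)) (z n)) \<and>
      (\<exists>\<epsilon>>0. \<exists>K. \<forall>n. \<epsilon> * real n - K \<le> h (z n))"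
    by (rule linear_growth_from_bounded_words[where f = ?f and g = g, OF gain \<open>\<delta> > 0\<close> le step \<open>C \<ge> 0\<close>])
  then obtain \<sigma> z \<epsilon> K where *: "\<forall>n. \<sigma> n \<in> {1, 2}" "\<forall>n. z (Suc n) = ?f (\<sigma> (Suc n)) (z n)"
    "\<epsilon> > 0" "\<And>n. \<epsilon> * real n - K \<le> h (z n)"
    by (elim exE conjE) blast
  have "\<epsilon> * real n - (K + D) \<le> cmod (z n)" for n
    using *(4)[of n] h[of "z n"] by linarith
  then have "\<exists>\<epsilon>>0. \<exists>K. \<forall>n. \<epsilon> * real n - K \<le> cmod (z n)"
    using \<open>\<epsilon> > 0\<close> by blast
  with *(1,2) show ?thesis by (intro exI[of _ \<sigma>] exI[of _ z] conjI)
qed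

section \<open>Upper-triangular matrices of order two\<close>

lemma mult_vector2:
  fixes M :: "'a::semiring_1^2^2"
  shows "M *v vector [x, y] = vector [M$1$1 * x + M$1$2 * y, M$2$1 * x + M$2$2 * y]"
  by (simp add: vec_eq_iff forall_2 matrix_vector_mult_def sum_2)

lemma eigenvalues_upper_triangular2:
  fixes M :: "'a::field^2^2"
  assumes "upper_triangular2 M"
  shows "eigenvalues M = {M$1$1, M$2$2}"
proof -
  have M: "M$2$1 = 0" using assms by (simp add: upper_triangular2_def)
  have "c = M$1$1 \<or> c = M$2$2" if v: "v \<noteq> 0" "M *v v = c *s v" for c v
    using v M by (auto simp: vec_eq_iff forall_2 matrix_vector_mult_def sum_2)
  moreover have "M *v vector [1, 0] = M$1$1 *s vector [1, 0]"
    using M by (simp add: mult_vector2 vec_eq_iff forall_2)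
  moreover have "M *v vector [M$1$2, M$2$2 - M$1$1] = M$2$2 *s vector [M$1$2, M$2$2 - M$1$1]"
    using M by (simp add: mult_vector2 vec_eq_iff forall_2 algebra_simps)
  moreover have "vector [1, 0] \<noteq> (0 :: 'a^2)" 
    by (simp add: vec_eq_iff forall_2)
  moreover have "vector [M$1$2, M$2$2 - M$1$1] \<noteq> (0 :: 'a^2)" if "M$1$1 \<noteq> M$2$2"
    using that by (simp add: vec_eq_iff forall_2)
  ultimately have "c \<in> eigenvalues M \<longleftrightarrow> c = M$1$1 \<or> c = M$2$2" for c
    unfolding eigenvalues_def mem_Collect_eq by metis
  then show ?thesis by auto
qed

lemma unimodular_diagonal:
  assumes "upper_triangular2 M" "spectral_radius M = 1" "cmod (det M) = 1"
  shows "cmod (M$1$1) = 1" "cmod (M$2$2) = 1"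
proof -
  have "cmod (M$1$1) \<le> 1" "cmod (M$2$2) \<le> 1"
    using assms(2) by (auto simp: spectral_radius_def eigenvalues_upper_triangular2[OF assms(1)])
  moreover have "cmod (M$1$1) * cmod (M$2$2) = 1"
    using assms(1,3) by (simp add: det_2 upper_triangular2_def flip: norm_mult)
  ultimately show "cmod (M$1$1) = 1" "cmod (M$2$2) = 1"
    by (smt (verit) mult_left_le mult_left_le_one_le norm_ge_zero)+
qed

lemma matrix_inv_cancel:
  fixes P :: "'a::semiring_1^'n^'m"
  assumes "invertible P"
  shows "matrix_inv P ** P = mat 1" "P ** matrix_inv P = mat 1"
  using someI_ex[OF assms[unfolded invertible_def]] by (auto simp: matrix_inv_def)

lemma matrix_inv_eqI:
  fixes P :: "'a::field^'n^'n"
  assumes "P ** Q = mat 1"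
  shows "invertible P" "matrix_inv P = Q"
proof -
  show P: "invertible P" 
    using assms matrix_left_right_inverse by (auto simp: invertible_def)
  have "matrix_inv P ** (P ** Q) = Q"
    using matrix_inv_cancel(1)[OF P] by (simp add: matrix_mul_assoc)
  then show "matrix_inv P = Q" using assms by simp
qed

lemma conjugate_mat:
  fixes P :: "'a::field^'n^'n"
  assumes "invertible P" shows "matrix_inv P ** mat c ** P = mat c"
proof -
  have "mat c ** P = P ** mat c"
    by (simp add: vec_eq_iff matrix_matrix_mult_def mat_def mult.commute if_distrib[where f = "\<lambda>x. x * _"]
        if_distrib[where f = "\<lambda>x. _ * x"] cong: if_cong)
  then show ?thesis
    using matrix_inv_cancel(1)[OF assms] by (metis matrix_mul_assoc matrix_mul_lid)
qed

lemma simultaneously_diagonalisable_scalar: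
  fixes B :: "'a::field^'n^'n"
  assumes "diagonalisable B"
  shows "simultaneously_diagonalisable (mat c) B" "simultaneously_diagonalisable B (mat c)"
proof -
  obtain P :: "'a^'n^'n" where P: "invertible P" "diagonal_matrix (matrix_inv P ** B ** P)"
    using assms by (auto simp: diagonalisable_def)
  moreover have "diagonal_matrix (matrix_inv P ** mat c ** P)"
    unfolding conjugate_mat[OF P(1)] by (simp add: diagonal_matrix_def mat_def)
  ultimately show "simultaneously_diagonalisable (mat c) B" "simultaneously_diagonalisable B (mat c)"
    by (auto simp: simultaneously_diagonalisable_def)
qed

text \<open>
The two columns of a diagonalising matrix are eigenvectors, and one of them has a nonzero second
entry. Its eigenvalue is the double diagonal entry, which leaves no room for a nonzero corner entry.
\<close>

lemma diagonalisable_equal_diagonal_imp_scalar: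
  fixes M :: "'a::field^2^2"
  assumes "upper_triangular2 M" "diagonalisable M" "M$1$1 = M$2$2"
  shows "M = mat (M$1$1)"
proof -
  obtain P :: "'a^2^2" where P: "invertible P" "diagonal_matrix (matrix_inv P ** M ** P)"
    using assms(2) by (auto simp: diagonalisable_def)
  define D where "D = matrix_inv P ** M ** P"
  have D: "D$1$2 = 0" "D$2$1 = 0"
    using P(2) by (auto simp: D_def diagonal_matrix_def)
  have eq: "M ** P = P ** D"
    using matrix_inv_cancel(2)[OF P(1)] by (simp add: D_def matrix_mul_assoc)
  have col: "M$1$1 * P$1$j + M$1$2 * P$2$j = P$1$j * D$j$j" "M$1$1 * P$2$j = P$2$j * D$j$j" for j
    using eq[THEN arg_cong, of "\<lambda>X. X$1$j"] eq[THEN arg_cong, of "\<lambda>X. X$2$j"]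
      assms(1,3) D exhaust_2[of j]
    by (auto simp: matrix_matrix_mult_def sum_2 upper_triangular2_def)
  have "P$2$1 \<noteq> 0 \<or> P$2$2 \<noteq> 0"
    using P(1) by (auto simp: invertible_det_nz det_2)
  then obtain j where j: "P$2$j \<noteq> 0" by blast
  then have "D$j$j = M$1$1" using col(2)[of j] by (simp add: mult.commute)
  then have "M$1$2 = 0" using col(1)[of j] j by (simp add: mult.commute)
  then show ?thesis
    using assms(1,3) by (simp add: vec_eq_iff forall_2 mat_def upper_triangular2_def)
qed

text \<open>
A fixed point \<open>p\<close> of the affine action is an eigenvector \<open>(p, 1)\<close>; together with \<open>(1, 0)\<close>, which is
an eigenvector of every upper-triangular matrix, it forms a basis.
\<close>

lemma simultaneously_diagonalisable_common_fixed_point: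
  fixes A B :: "'a::field^2^2"
  assumes "upper_triangular2 A" "upper_triangular2 B"
    and "A$1$1 * p + A$1$2 = A$2$2 * p" "B$1$1 * p + B$1$2 = B$2$2 * p"
  shows "simultaneously_diagonalisable A B"
proof -
  define P :: "'a^2^2" where "P = vector [vector [1, p], vector [0, 1]]"
  define Q :: "'a^2^2" where "Q = vector [vector [1, - p], vector [0, 1]]"
  have "P ** Q = mat 1"
    by (simp add: P_def Q_def vec_eq_iff forall_2 matrix_matrix_mult_def sum_2 mat_def)
  note inv = matrix_inv_eqI[OF this]
  have diag: "diagonal_matrix (matrix_inv P ** M ** P)"
    if "upper_triangular2 M" "M$1$1 * p + M$1$2 = M$2$2 * p" for M
    using that unfolding inv(2)
    by (simp add: P_def Q_def diagonal_matrix_def forall_2 matrix_matrix_mult_def sum_2 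
        upper_triangular2_def algebra_simps)
  show ?thesis
    using inv(1) diag[of A] diag[of B] assms by (auto simp: simultaneously_diagonalisable_def)
qed

text \<open>
The product maps \<open>(z 0, 1)\<close> to a multiple of \<open>(z n, 1)\<close>. The factor is a product of lower diagonal
entries and hence unimodular, so the first coordinate has the modulus of \<open>z n\<close>.
\<close>

lemma norm_matrix_product_ge_projective_orbit:
  fixes B :: "nat \<Rightarrow> complex^2^2"
  assumes "\<And>n. upper_triangular2 (B n)" "\<And>n. cmod (B n $2$2) = 1"
    and z: "\<And>n. z (Suc n) = (B (Suc n) $1$1 * z n + B (Suc n) $1$2) / B (Suc n) $2$2"
  shows "cmod (z n) \<le> norm (matrix_product B n *v vector [z 0, 1])"
proof -
  have "\<exists>s. cmod s = 1 \<and> matrix_product B n *v vector [z 0, 1] = vector [s * z n, s]"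
  proof (induction n)
    case 0
    show ?case by (intro exI[of _ 1]) simp
  next
    case (Suc n)
    then obtain s where s: "cmod s = 1" "matrix_product B n *v vector [z 0, 1] = vector [s * z n, s]"
      by blast
    have "B (Suc n) $2$2 \<noteq> 0" using assms(2)[of "Suc n"] by auto
    have "matrix_product B (Suc n) *v vector [z 0, 1] = B (Suc n) *v vector [s * z n, s]"
      unfolding matrix_product.simps matrix_vector_mul_assoc[symmetric] s(2) ..
    also have "\<dots> = vector [B (Suc n) $2$2 * s * z (Suc n), B (Suc n) $2$2 * s]"
    proof -
      have "B (Suc n) $2$2 * s * z (Suc n) = s * (B (Suc n) $2$2 * z (Suc n))"
        by simp
      also have "\<dots> = s * (B (Suc n) $1$1 * z n + B (Suc n) $1$2)"
        using \<open>B (Suc n) $2$2 \<noteq> 0\<close> by (simp add: z)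
      finally have "B (Suc n) $2$2 * s * z (Suc n) = B (Suc n) $1$1 * (s * z n) + B (Suc n) $1$2 * s"
        by (simp add: distrib_left mult_ac)
      then show ?thesis
        using assms(1)[of "Suc n"] by (simp only: mult_vector2) (simp add: upper_triangular2_def)
    qed
    finally have "matrix_product B (Suc n) *v vector [z 0, 1] =
        vector [B (Suc n) $2$2 * s * z (Suc n), B (Suc n) $2$2 * s]" .
    moreover have "cmod (B (Suc n) $2$2 * s) = 1"
      using s(1) assms(2) by (simp add: norm_mult)
    ultimately show ?case by blast
  qed
  then obtain s where "cmod s = 1" "matrix_product B n *v vector [z 0, 1] = vector [s * z n, s]"
    by blast
  then show ?thesis
    using Finite_Cartesian_Product.norm_nth_le[of "matrix_product B n *v vector [z 0, 1]" 1]
    by (simp add: norm_mult)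
qed

section \<open>Linear growth of a product\<close>

lemma liminf_average_pos:
  fixes a :: "nat \<Rightarrow> real"
  assumes "\<epsilon> > 0" and lb: "\<And>n. \<epsilon> * real n - K \<le> a n"
  shows "liminf (\<lambda>n. ereal (1 / real n * a n)) > 0"
proof -
  obtain m :: nat where m: "2 * K / \<epsilon> < real m"
    using reals_Archimedean2 by blast
  have "\<epsilon> / 2 \<le> 1 / real n * a n" if "n \<ge> Suc m" for n
  proof -
    have "2 * K / \<epsilon> \<le> real n" "0 < real n" using m that by linarith+
    then have "\<epsilon> / 2 * real n \<le> a n"
      using lb[of n] \<open>\<epsilon> > 0\<close> by (simp add: field_simps)
    then show ?thesis using \<open>0 < real n\<close> by (simp add: field_simps)
  qed
  then have "ereal (\<epsilon> / 2) \<le> liminf (\<lambda>n. ereal (1 / real n * a n))"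
    by (intro Liminf_bounded eventually_sequentiallyI[of "Suc m"]) simp
  moreover have "0 < ereal (\<epsilon> / 2)" using \<open>\<epsilon> > 0\<close> by simp
  ultimately show ?thesis by (rule less_le_trans[rotated])
qed

theorem proposition2p4:
  fixes A :: "nat \<Rightarrow> complex^2^2"
  assumes "upper_triangular2 (A 1)" and "upper_triangular2 (A 2)"
    and "diagonalisable (A 1)" and "diagonalisable (A 2)"
    and "\<not> simultaneously_diagonalisable (A 1) (A 2)"
    and "spectral_radius (A 1) = 1" and "spectral_radius (A 2) = 1"
    and "cmod (det (A 1)) = 1" and "cmod (det (A 2)) = 1"
  shows "\<exists>(\<sigma> :: nat \<Rightarrow> nat) (v :: complex^2).
           \<sigma> \<in> {1..} \<rightarrow> {1, 2} \<and>
           liminf (\<lambda>n. ereal (1 / real n * norm (matrix_product (\<lambda>k. A (\<sigma> k)) n *v v))) > 0"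
proof -
  \<comment> \<open>Multiplier and centre of the rotation that \<open>A i\<close> induces on the affine chart.\<close>
  define c where "c i = A i $1$1 / A i $2$2" for i
  define p where "p i = A i $1$2 / (A i $2$2 - A i $1$1)" for i
  have upper: "upper_triangular2 (A i)" if "i \<in> {1, 2}" for i
    using assms(1,2) that by auto
  have unit: "cmod (A i $1$1) = 1" "cmod (A i $2$2) = 1" if "i \<in> {1, 2}" for i
    using unimodular_diagonal assms that by auto
  have distinct: "A i $1$1 \<noteq> A i $2$2" if "i \<in> {1, 2}" for i
  proof
    assume "A i $1$1 = A i $2$2"
    then have "A i = mat (A i $1$1)"
      using that assms(1-4) by (intro diagonalisable_equal_diagonal_imp_scalar) auto
    then show False
      using that assms(3-5) simultaneously_diagonalisable_scalar by (metis insertE singletonD)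
  qed
  have fixed: "A i $1$1 * p i + A i $1$2 = A i $2$2 * p i" if "i \<in> {1, 2}" for i
    using distinct[OF that] by (simp add: p_def field_simps)
  have "p 1 \<noteq> p 2"
    using simultaneously_diagonalisable_common_fixed_point[of "A 1" "A 2" "p 1"]
      fixed[of 1] fixed[of 2] assms(1,2,5) by auto
  moreover have "cmod (c i) = 1 \<and> c i \<noteq> 1" if "i \<in> {1, 2}" for i
    using unit[OF that] distinct[OF that] by (auto simp: c_def norm_divide)
  ultimately obtain \<sigma> z \<epsilon> K where *: "\<And>n. \<sigma> n \<in> {1, 2}"
    "\<And>n. z (Suc n) = rotation (p (\<sigma> (Suc n))) (c (\<sigma> (Suc n))) (z n)"
    "\<epsilon> > 0" "\<And>n. \<epsilon> * real n - K \<le> cmod (z n)"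
    using rotation_orbits_escape[of c p] by blast
  have rot: "rotation (p i) (c i) x = (A i $1$1 * x + A i $1$2) / A i $2$2" if "i \<in> {1, 2}" for i x
  proof -
    have "A i $2$2 \<noteq> 0" using unit[OF that] by auto
    have "rotation (p i) (c i) x = (A i $2$2 * p i - A i $1$1 * p i + A i $1$1 * x) / A i $2$2"
      using \<open>A i $2$2 \<noteq> 0\<close> by (simp add: rotation_def c_def field_simps)
    then show ?thesis by (simp flip: fixed[OF that] add: add.commute)
  qed
  have "cmod (z n) \<le> norm (matrix_product (\<lambda>k. A (\<sigma> k)) n *v vector [z 0, 1])" for n
    using upper unit *(1) by (intro norm_matrix_product_ge_projective_orbit) (auto simp: *(2) rot)
  then have "\<epsilon> * real n - K \<le> norm (matrix_product (\<lambda>k. A (\<sigma> k)) n *v vector [z 0, 1])" for n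
    using *(4) order_trans by blast
  from liminf_average_pos[OF \<open>\<epsilon> > 0\<close> this] show ?thesis
    using *(1) by (intro exI[of _ \<sigma>] exI[of _ "vector [z 0, 1]"]) auto
qed

end
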